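(* Let $n\ge 1$, $1<p<\infty$, and let $w$ be a weight on $\mathbb{R}^n$ that satisfies the $C_p$ condition and is doubling with doubling constant $C_w<3^{np}$, i.e. $w(3I)\le C_w\,w(I)$ for all cubes $I\subset\mathbb{R}^n$. Then $w\in A_\infty$.
   Context: A weight on $\mathbb{R}^n$ is a nonnegative locally integrable function $w$ that is not a.e. zero; $|E|_w=w(E)=\int_E w(x)\,dx$, and $|E|$ denotes Lebesgue measure. $3I$ denotes the cube with the same center as $I$ and three times its side length. $C_p$ condition ($1<p<\infty$): $w$ satisfies the $C_p$ condition if there exist $C,\epsilon>0$ such that for every cube $I$ one has $\int_{\mathbb{R}^n}(M\mathbf{1}_I(x))^p w(x)\,dx<\infty$ and $$\frac{|E|_w}{\int_{\mathbb{R}^n}|M\mathbf{1}_I(x)|^p w(x)\,dx}\le C\left(\frac{|E|}{|I|}\right)^{\epsilon}\quad\text{for every compact } E\subset I,$$ where $M$ is the classical Hardy–Littlewood maximal operator. $A_\infty$: $w\in A_\infty$ if there exist constants $C,\varepsilon>0$ such that $\frac{w(E)}{w(I)}\le C\left(\frac{|E|}{|I|}\right)^{\varepsilon}$ for all cubes $I\subset\mathbb{R}^n$ and all measurable $E\subset I$ (equivalently $w\in\bigcup_{q>1}A_q$, the union of the Muckenhoupt classes). *)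

theory Defs
  imports "HOL-Analysis.Analysis"
begin

definition weight :: "(real ^ 'n \<Rightarrow> real) \<Rightarrow> bool" where
  "weight w \<longleftrightarrow>
     (\<forall>x. 0 \<le> w x) \<and>
     (\<forall>K. compact K \<longrightarrow> set_integrable lebesgue K w) \<and>
     \<not> (AE x in lebesgue. w x = 0)"

definition wmeas :: "(real ^ 'n \<Rightarrow> real) \<Rightarrow> (real ^ 'n) set \<Rightarrow> ennreal" where
  "wmeas w E = (\<integral>\<^sup>+x\<in>E. ennreal (w x) \<partial>lebesgue)"

text \<open>Cubes are closed with sides parallel to the coordinate axes; \<open>cube c l\<close> has center \<open>c\<close>
  and side length \<open>l\<close>, and is only used with \<open>l > 0\<close>. Thus \<open>3I\<close> is \<open>cube c (3 * l)\<close>.\<close>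

definition cube :: "real ^ 'n \<Rightarrow> real \<Rightarrow> (real ^ 'n) set" where
  "cube c l = cbox (c - (\<chi> i. l / 2)) (c + (\<chi> i. l / 2))"

text \<open>The uncentered Hardy--Littlewood maximal function over cubes.\<close>

definition HL_max :: "(real ^ 'n \<Rightarrow> real) \<Rightarrow> real ^ 'n \<Rightarrow> ennreal" where
  "HL_max f x =
     (SUP Q \<in> {cube c l | c l. 0 < l \<and> x \<in> cube c l}.
        (\<integral>\<^sup>+y\<in>Q. ennreal \<bar>f y\<bar> \<partial>lebesgue) / emeasure lebesgue Q)"

text \<open>The type \<open>ennreal\<close> has no real powers, so the power of the maximal function of an indicator
  is taken in the reals. By the following bound, \<open>enn2real\<close> loses nothing here.\<close>

lemma HL_max_indicator_le_1:
  fixes x :: "real ^ 'n"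
  shows "HL_max (indicator A) x \<le> 1"
  unfolding HL_max_def
proof (rule SUP_least)
  fix Q :: "(real ^ 'n) set"
  assume "Q \<in> {cube c l | c l. 0 < l \<and> x \<in> cube c l}"
  then have Q: "Q \<in> sets lebesgue" by (auto simp: cube_def)
  have "(\<integral>\<^sup>+y\<in>Q. ennreal \<bar>indicator A y\<bar> \<partial>lebesgue) \<le> (\<integral>\<^sup>+y. indicator Q y \<partial>lebesgue)"
    by (rule nn_integral_mono) (auto simp: indicator_def)
  also have "\<dots> = emeasure lebesgue Q" using Q by simp
  finally have "(\<integral>\<^sup>+y\<in>Q. ennreal \<bar>indicator A y\<bar> \<partial>lebesgue) / emeasure lebesgue Q
      \<le> emeasure lebesgue Q / emeasure lebesgue Q"
    by (rule divide_right_mono_ennreal)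
  also have "\<dots> \<le> 1"
    by (cases "emeasure lebesgue Q = 0 \<or> emeasure lebesgue Q = top") (auto simp: less_top)
  finally show "(\<integral>\<^sup>+y\<in>Q. ennreal \<bar>indicator A y\<bar> \<partial>lebesgue) / emeasure lebesgue Q \<le> 1" .
qed

definition Cp_tail :: "real \<Rightarrow> (real ^ 'n \<Rightarrow> real) \<Rightarrow> (real ^ 'n) set \<Rightarrow> ennreal" where
  "Cp_tail p w I =
     (\<integral>\<^sup>+x. ennreal (enn2real (HL_max (indicator I) x) powr p * w x) \<partial>lebesgue)"

definition Cp_condition :: "real \<Rightarrow> (real ^ 'n \<Rightarrow> real) \<Rightarrow> bool" where
  "Cp_condition p w \<longleftrightarrow>
     (\<exists>C>0. \<exists>\<epsilon>>0. \<forall>c l. 0 < l \<longrightarrow>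
        Cp_tail p w (cube c l) < \<infinity> \<and>
        (\<forall>E. compact E \<and> E \<subseteq> cube c l \<longrightarrow>
           wmeas w E / Cp_tail p w (cube c l)
             \<le> ennreal (C * (measure lebesgue E / measure lebesgue (cube c l)) powr \<epsilon>)))"

definition doubling_with :: "real \<Rightarrow> (real ^ 'n \<Rightarrow> real) \<Rightarrow> bool" where
  "doubling_with D w \<longleftrightarrow>
     (\<forall>c l. 0 < l \<longrightarrow> wmeas w (cube c (3 * l)) \<le> ennreal D * wmeas w (cube c l))"

text \<open>In \<open>ennreal\<close>, \<open>0 / 0 = 0\<close>. This does not weaken the condition: a weight vanishing a.e. on
  some cube violates it for cubes slightly larger than the largest concentric such cube.\<close>

definition A_infinity :: "(real ^ 'n \<Rightarrow> real) set" where
  "A_infinity = {w. weight w \<and>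
     (\<exists>C>0. \<exists>\<epsilon>>0. \<forall>c l. 0 < l \<longrightarrow>
        (\<forall>E. E \<in> sets lebesgue \<and> E \<subseteq> cube c l \<longrightarrow>
           wmeas w E / wmeas w (cube c l)
             \<le> ennreal (C * (measure lebesgue E / measure lebesgue (cube c l)) powr \<epsilon>)))}"

end

theory Submission
  imports Defs
begin

text \<open>
  The \<open>C\<^sub>p\<close> condition is the \<open>A\<^sub>\<infinity>\<close> inequality with the tail
  \<open>\<integral> (M 1\<^sub>I)\<^sup>p w\<close> in place of \<open>w(I)\<close>. It therefore suffices to bound the tail by
  a constant multiple of \<open>w(I)\<close>.

  Outside \<open>3\<^sup>k I\<close> a cube that meets \<open>I\<close> has side length at least \<open>3\<^sup>k / 3\<close> times that
  of \<open>I\<close>, so \<open>M 1\<^sub>I\<close> is at most \<open>(3 / 3\<^sup>k)\<^sup>n\<close> there (\<open>HL_max_indicator_cube_outside\<close>).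
  On the shell between \<open>3\<^sup>k I\<close> and \<open>3 \<cdot> 3\<^sup>k I\<close>, the integrand of the tail is thus at most
  \<open>q / q\<^sup>k \<cdot> w\<close> with \<open>q\<close> the number \<open>3\<close> to the power \<open>n p\<close>. Iterating the doubling
  inequality with constant \<open>D\<close> shows that the shell has \<open>w\<close>-measure at most \<open>D \<cdot> D\<^sup>k w(I)\<close>.
  The contributions of the shells form a geometric series with ratio \<open>D / q\<close>, which
  converges exactly because \<open>D < q\<close> (\<open>Cp_tail_le_wmeas\<close>).

  This gives the \<open>A\<^sub>\<infinity>\<close> inequality for compact subsets of \<open>I\<close>, with the same exponent.
  It passes to measurable subsets by inner regularity of \<open>w dx\<close> (\<open>wmeas_le_if_compact_le\<close>).
\<close>

section \<open>Cubes\<close>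

lemma mem_cube_iff: "x \<in> cube c l \<longleftrightarrow> (\<forall>i. \<bar>x $ i - c $ i\<bar> \<le> l / 2)"
proof -
  have "c $ i - l / 2 \<le> x $ i \<and> x $ i \<le> c $ i + l / 2 \<longleftrightarrow> \<bar>x $ i - c $ i\<bar> \<le> l / 2" for i
    by linarith
  then show ?thesis by (simp add: cube_def mem_box_cart)
qed

lemma cube_sets_lebesgue [measurable]: "cube c l \<in> sets lebesgue"
  unfolding cube_def by simp

lemma compact_cube: "compact (cube c l)"
  unfolding cube_def by (rule compact_cbox)

lemma emeasure_cube:
  fixes c :: "real ^ 'n"
  assumes "0 < l"
  shows "emeasure lebesgue (cube c l) = ennreal (l ^ CARD('n))"
proof -
  have "c \<in> cube c l" using assms by (simp add: mem_cube_iff)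
  then have "measure lborel (cube c l) = l ^ CARD('n)"
    unfolding cube_def by (subst content_cbox_cart) auto
  moreover have "emeasure lborel (cube c l) = ennreal (measure lborel (cube c l))"
    unfolding cube_def using emeasure_lborel_cbox_finite
    by (intro emeasure_eq_ennreal_measure) (simp add: less_top)
  ultimately show ?thesis
    by (simp add: cube_def)
qed

lemma in_some_tripled_cube:
  fixes x c :: "real ^ 'n"
  assumes "0 < l"
  shows "\<exists>k. x \<in> cube c (3 ^ k * l)"
proof -
  obtain k where k: "2 * norm (x - c) / l < 3 ^ k"
    using real_arch_pow[of 3] by auto
  have "\<bar>x $ i - c $ i\<bar> \<le> 3 ^ k * l / 2" for i
    using component_le_norm_cart[of "x - c" i] k assms by (simp add: field_simps)
  then show ?thesis by (auto simp: mem_cube_iff)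
qed

section \<open>Decay of the maximal function of a cube\<close>

text \<open>In the sup norm, a point outside \<open>3 \<cdot> 3\<^sup>k I\<close> is farther than \<open>(3 \<cdot> 3\<^sup>k - 1) l / 2\<close>
  from \<open>I\<close>, and this is at least \<open>3\<^sup>k l\<close>.\<close>

lemma side_ge_if_meets_and_leaves:
  assumes "0 < l" and x: "x \<in> cube c' s" "x \<notin> cube c (3 ^ Suc k * l)"
    and y: "y \<in> cube c' s" "y \<in> cube c l"
  shows "3 ^ k * l \<le> s"
proof -
  obtain i where i: "3 ^ Suc k * l / 2 < \<bar>x $ i - c $ i\<bar>"
    using x(2) by (auto simp: mem_cube_iff not_le)
  have "\<bar>x $ i - c' $ i\<bar> \<le> s / 2" "\<bar>y $ i - c' $ i\<bar> \<le> s / 2" "\<bar>y $ i - c $ i\<bar> \<le> l / 2"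
    using x(1) y by (auto simp: mem_cube_iff)
  with i have "3 ^ Suc k * l / 2 < s + l / 2" by linarith
  then have "3 * (3 ^ k * l) < 2 * s + l" by simp
  moreover have "1 * l \<le> 3 ^ k * l"
    using assms(1) by (intro mult_right_mono) auto
  ultimately show ?thesis by simp
qed

text \<open>An average of \<open>1\<^sub>I\<close> over a cube \<open>Q\<close> is nonzero only if \<open>Q\<close> meets \<open>I\<close>, and it is at
  most \<open>|I| / |Q|\<close>; a cube reaching from \<open>I\<close> to a far point is large. For \<open>k = 0\<close> the
  bound exceeds the trivial bound \<open>1\<close>.\<close>

lemma HL_max_indicator_cube_outside:
  fixes x c :: "real ^ 'n"
  assumes l: "0 < l" and x: "x \<notin> cube c (3 ^ k * l)"
  shows "HL_max (indicator (cube c l)) x \<le> ennreal ((3 / 3 ^ k) ^ CARD('n))"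
proof (cases k)
  case 0
  have "(1::real) \<le> 3 ^ CARD('n)" by simp
  then have "(1::ennreal) \<le> ennreal ((3 / 3 ^ k) ^ CARD('n))"
    using 0 by (metis div_by_1 ennreal_1 ennreal_leI power_0)
  then show ?thesis using HL_max_indicator_le_1 order_trans by blast
next
  case (Suc m)
  show ?thesis
    unfolding HL_max_def
  proof (rule SUP_least, clarify)
    fix c' :: "real ^ 'n" and s :: real
    assume s: "0 < s" and xQ: "x \<in> cube c' s"
    let ?J = "\<integral>\<^sup>+y\<in>cube c' s. ennreal \<bar>indicator (cube c l) y\<bar> \<partial>lebesgue"
    show "?J / emeasure lebesgue (cube c' s) \<le> ennreal ((3 / 3 ^ k) ^ CARD('n))"
    proof (cases "cube c' s \<inter> cube c l = {}")
      case True
      then have "?J = (\<integral>\<^sup>+y. 0 \<partial>(lebesgue :: (real ^ 'n) measure))"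
        by (intro nn_integral_cong) (auto simp: indicator_def)
      then show ?thesis by simp
    next
      case False
      then obtain y where y: "y \<in> cube c' s" "y \<in> cube c l" by auto
      have ls: "3 ^ m * l \<le> s"
        using side_ge_if_meets_and_leaves[OF l xQ _ y] x Suc by blast
      have "?J \<le> (\<integral>\<^sup>+y. indicator (cube c l) y \<partial>lebesgue)"
        by (rule nn_integral_mono) (auto simp: indicator_def)
      also have "\<dots> = ennreal (l ^ CARD('n))"
        by (subst nn_integral_indicator) (use l in \<open>simp_all only: emeasure_cube cube_sets_lebesgue\<close>)
      finally have "?J / emeasure lebesgue (cube c' s)
          \<le> ennreal (l ^ CARD('n)) / ennreal (s ^ CARD('n))"
        by (simp only: emeasure_cube[OF s] divide_right_mono_ennreal)
      also have "\<dots> = ennreal ((l / s) ^ CARD('n))"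
        using l s by (simp add: divide_ennreal power_divide)
      also have "\<dots> \<le> ennreal ((3 / 3 ^ k) ^ CARD('n))"
        using l s ls Suc by (intro ennreal_leI power_mono) (auto simp: field_simps)
      finally show ?thesis .
    qed
  qed
qed

section \<open>The weighted measure\<close>

text \<open>A weight is the pointwise limit of its truncations to growing balls, and those are
  integrable.\<close>

lemma weight_borel_measurable:
  fixes w :: "real ^ 'n \<Rightarrow> real"
  assumes "weight w"
  shows "w \<in> borel_measurable lebesgue"
proof (rule borel_measurable_LIMSEQ_real)
  fix n :: nat
  have "set_integrable lebesgue (cball 0 (real n)) w"
    using assms by (simp add: weight_def)
  then show "(\<lambda>x. indicator (cball 0 (real n)) x * w x) \<in> borel_measurable lebesgue"
    by (auto simp: set_integrable_def dest: borel_measurable_integrable)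
next
  fix x :: "real ^ 'n"
  obtain N where N: "norm x \<le> real N" using real_arch_simple by blast
  have "indicator (cball 0 (real n)) x * w x = w x" if "N \<le> n" for n
    using that N by (simp add: indicator_def)
  then have "eventually (\<lambda>n. indicator (cball 0 (real n)) x * w x = w x) sequentially"
    by (auto simp: eventually_sequentially)
  then show "(\<lambda>n. indicator (cball 0 (real n)) x * w x) \<longlonglongrightarrow> w x"
    by (rule tendsto_eventually)
qed

lemma wmeas_eq_emeasure_density:
  assumes "weight w" "E \<in> sets lebesgue"
  shows "wmeas w E = emeasure (density lebesgue (\<lambda>x. ennreal (w x))) E"
  using weight_borel_measurable[OF assms(1)] assms(2)
  by (simp add: wmeas_def emeasure_density)

lemma wmeas_tripled_cube_le:
  assumes D: "doubling_with D w" and "0 \<le> D" "0 < l"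
  shows "wmeas w (cube c (3 ^ k * l)) \<le> ennreal (D ^ k) * wmeas w (cube c l)"
proof (induction k)
  case (Suc k)
  have "wmeas w (cube c (3 ^ Suc k * l)) \<le> ennreal D * wmeas w (cube c (3 ^ k * l))"
    using D \<open>0 < l\<close> by (auto simp: doubling_with_def mult.assoc)
  also have "\<dots> \<le> ennreal D * (ennreal (D ^ k) * wmeas w (cube c l))"
    using Suc by (rule mult_left_mono) simp
  finally show ?case
    using \<open>0 \<le> D\<close> by (simp add: ennreal_mult mult.assoc)
qed simp

text \<open>Inner regularity: up to a Lebesgue null set, which is also null for \<open>w dx\<close>, a measurable
  set is an increasing union of compact sets.\<close>

lemma wmeas_le_if_compact_le:
  fixes w :: "real ^ 'n \<Rightarrow> real"
  assumes w: "weight w" and E: "E \<in> sets lebesgue"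
    and le: "\<And>K. compact K \<Longrightarrow> K \<subseteq> E \<Longrightarrow> wmeas w K \<le> b"
  shows "wmeas w E \<le> b"
proof -
  let ?\<mu> = "density lebesgue (\<lambda>x. ennreal (w x))"
  note w_meas [measurable] = weight_borel_measurable[OF w]
  obtain F N where F: "fsigma F" "N \<in> null_sets lebesgue" "F \<union> N = E"
    using lebesgue_set_almost_fsigma[OF E] by metis
  obtain K :: "nat \<Rightarrow> (real ^ 'n) set" where K: "\<And>n. compact (K n)" "F = (\<Union>n. K n)"
  proof -
    obtain K :: "nat \<Rightarrow> (real ^ 'n) set" where "range K \<subseteq> Collect compact" "F = \<Union>(range K)"
      using F(1) fsigma_Union_compact by metis
    then show thesis by (intro that[of K]) auto
  qed
  define L where "L n = (\<Union>i\<le>n. K i)" for n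
  have L: "compact (L n)" for n
    unfolding L_def using K(1) by (intro compact_UN) auto
  then have L_sets: "L n \<in> sets lebesgue" for n
    by (metis lmeasurable_compact fmeasurableD)
  have L_mono: "incseq L"
    unfolding L_def by (intro monoI UN_mono) auto
  have L_un: "(\<Union>n. L n) = F" unfolding L_def K(2) by auto
  have N0: "N \<in> null_sets ?\<mu>"
    using F(2) absolutely_continuousI_density[of "\<lambda>x. ennreal (w x)" lebesgue]
    by (auto simp: absolutely_continuous_def)
  have "wmeas w E = emeasure ?\<mu> (F \<union> N)"
    using F(3) E w by (simp add: wmeas_eq_emeasure_density)
  also have "\<dots> = emeasure ?\<mu> F"
    using N0 L_sets L_un by (intro emeasure_Un_null_set) (auto simp flip: L_un)
  also have "\<dots> = (SUP n. emeasure ?\<mu> (L n))"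
    unfolding L_un[symmetric]
    using L_sets by (intro SUP_emeasure_incseq[symmetric]) (auto intro: L_mono)
  also have "\<dots> \<le> b"
  proof (rule SUP_least)
    fix n
    have "L n \<subseteq> E" using L_un F(3) by blast
    then show "emeasure ?\<mu> (L n) \<le> b"
      using le[OF L] L_sets w by (simp add: wmeas_eq_emeasure_density)
  qed
  finally show ?thesis .
qed

section \<open>Doubling controls the tail\<close>

text \<open>The integrand is dominated by a sum of multiples of \<open>w\<close> restricted to the full cubes
  \<open>3 \<cdot> 3\<^sup>k I\<close> rather than to the shells. The overlap costs nothing, since the estimate
  for each shell goes through the cube that contains it.\<close>

lemma Cp_tail_le_wmeas:
  fixes w :: "real ^ 'n \<Rightarrow> real"
  assumes "0 < p" and w: "weight w" and D: "doubling_with D w" "0 \<le> D"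
    and small: "D < 3 powr (real CARD('n) * p)"
  obtains K where "0 < K"
    and "\<And>c l. 0 < l \<Longrightarrow> Cp_tail p w (cube c l) \<le> ennreal K * wmeas w (cube c l)"
proof -
  define q where "q = 3 powr (real CARD('n) * p)"
  define r where "r = D / q"
  define a where "a k = q / q ^ k" for k :: nat
  have q: "0 < q" by (simp add: q_def)
  have r: "0 \<le> r" "r < 1" using D(2) small q by (auto simp: r_def q_def[symmetric])
  have a_nonneg: "0 \<le> a k" for k using q by (simp add: a_def)
  have a_eq: "((3 / 3 ^ k) ^ CARD('n)) powr p = a k" for k :: nat
  proof -
    have "((3::real) ^ m) powr p = (3 powr p) ^ m" for m
      by (simp add: powr_power powr_powr flip: powr_realpow) (simp add: mult.commute)
    moreover have "q = (3 powr p) ^ CARD('n)"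
      by (simp add: q_def powr_power mult.commute)
    ultimately show ?thesis
      by (simp add: a_def power_divide powr_divide flip: power_mult) (simp add: mult.commute)
  qed
  have aD: "a k * D ^ Suc k = q * D * r ^ k" for k
    by (simp add: a_def r_def power_divide)
  let ?K = "q * D / (1 - r)"
  have sums: "(\<lambda>k. a k * D ^ Suc k) sums ?K"
    unfolding aD using sums_mult[OF geometric_sums[of r], of "q * D"] r by simp
  note w_meas [measurable] = weight_borel_measurable[OF w]
  have bound: "Cp_tail p w (cube c l) \<le> ennreal ?K * wmeas w (cube c l)" if l: "0 < l" for c l
  proof -
    let ?h = "\<lambda>x. enn2real (HL_max (indicator (cube c l)) x)"
    let ?I = "\<lambda>k. cube c (3 ^ Suc k * l)"
    let ?g = "\<lambda>k x. ennreal (a k) * (ennreal (w x) * indicator (?I k) x)"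
    have pointwise: "ennreal (?h x powr p * w x) \<le> (\<Sum>k. ?g k x)" for x
    proof -
      have "\<exists>k. x \<in> ?I k \<and> ?h x powr p \<le> a k"
      proof (cases "x \<in> cube c l")
        case True
        have "\<bar>x $ i - c $ i\<bar> \<le> 3 * l / 2" for i
        proof -
          have "\<bar>x $ i - c $ i\<bar> \<le> l / 2" using True by (simp add: mem_cube_iff)
          then show ?thesis using l by linarith
        qed
        then have in0: "x \<in> ?I 0" by (simp add: mem_cube_iff)
        have "?h x \<le> 1"
          using enn2real_mono[OF HL_max_indicator_le_1] by fastforce
        then have "?h x powr p \<le> 1 powr p"
          using \<open>0 < p\<close> by (intro powr_mono2) auto
        also have "\<dots> \<le> a 0"
          using \<open>0 < p\<close> by (simp add: a_def q_def ge_one_powr_ge_zero)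
        finally show ?thesis using in0 by blast
      next
        case False
        \<comment> \<open>the first cube of the sequence that contains \<open>x\<close> places it in a shell\<close>
        define k where "k = (LEAST k. x \<in> cube c (3 ^ k * l))"
        have xk: "x \<in> cube c (3 ^ k * l)"
          unfolding k_def using in_some_tripled_cube[OF l] by (rule LeastI_ex)
        with False obtain m where m: "k = Suc m" by (cases k) auto
        have "x \<notin> cube c (3 ^ m * l)"
          using m unfolding k_def by (intro not_less_Least) simp
        from enn2real_mono[OF HL_max_indicator_cube_outside[OF l this]]
        have "?h x \<le> (3 / 3 ^ m) ^ CARD('n)" by simp
        then have "?h x powr p \<le> ((3 / 3 ^ m) ^ CARD('n)) powr p"
          using \<open>0 < p\<close> by (intro powr_mono2) auto
        then show ?thesis using xk m a_eq by auto
      qed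
      then obtain k where k: "x \<in> ?I k" "?h x powr p \<le> a k" by blast
      have "0 \<le> w x" using w by (simp add: weight_def)
      then have "ennreal (?h x powr p * w x) \<le> ennreal (a k * w x)"
        using k(2) by (intro ennreal_leI mult_right_mono)
      also have "\<dots> = ?g k x"
        using k(1) a_nonneg \<open>0 \<le> w x\<close> by (simp add: ennreal_mult)
      also have "\<dots> \<le> (\<Sum>k. ?g k x)"
        using sum_le_suminf[of "\<lambda>k. ?g k x" "{k}"] by simp
      finally show ?thesis .
    qed
    have "Cp_tail p w (cube c l) \<le> (\<integral>\<^sup>+x. (\<Sum>k. ?g k x) \<partial>lebesgue)"
      unfolding Cp_tail_def by (rule nn_integral_mono) (rule pointwise)
    also have "\<dots> = (\<Sum>k. \<integral>\<^sup>+x. ?g k x \<partial>lebesgue)"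
      by (rule nn_integral_suminf) measurable
    also have "\<dots> = (\<Sum>k. ennreal (a k) * wmeas w (?I k))"
      unfolding wmeas_def by (intro suminf_cong nn_integral_cmult) measurable
    also have "\<dots> \<le> (\<Sum>k. ennreal (a k * D ^ Suc k) * wmeas w (cube c l))"
    proof (intro suminf_le summableI)
      fix k
      have "ennreal (a k) * wmeas w (?I k)
          \<le> ennreal (a k) * (ennreal (D ^ Suc k) * wmeas w (cube c l))"
        by (intro mult_left_mono wmeas_tripled_cube_le D l) simp
      also have "\<dots> = ennreal (a k * D ^ Suc k) * wmeas w (cube c l)"
        using a_nonneg D(2) by (simp add: ennreal_mult mult.assoc)
      finally show "ennreal (a k) * wmeas w (?I k)
          \<le> ennreal (a k * D ^ Suc k) * wmeas w (cube c l)" .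
    qed
    also have "\<dots> = ennreal ?K * wmeas w (cube c l)"
    proof -
      have "(\<Sum>k. ennreal (a k * D ^ Suc k)) = ennreal ?K"
        by (rule suminf_ennreal_eq[OF _ sums]) (intro mult_nonneg_nonneg a_nonneg zero_le_power D(2))
      then show ?thesis by (simp only: ennreal_suminf_multc)
    qed
    finally show ?thesis .
  qed
  show thesis
  proof
    \<comment> \<open>\<open>?K\<close> vanishes if \<open>D = 0\<close>, and a positive constant is required\<close>
    show "0 < ?K + 1" using q r D(2) by (simp add: add_nonneg_pos)
    fix c :: "real ^ 'n" and l :: real
    assume "0 < l"
    then have "Cp_tail p w (cube c l) \<le> ennreal ?K * wmeas w (cube c l)" by (rule bound)
    also have "\<dots> \<le> ennreal (?K + 1) * wmeas w (cube c l)"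
      by (intro mult_right_mono ennreal_leI) auto
    finally show "Cp_tail p w (cube c l) \<le> ennreal (?K + 1) * wmeas w (cube c l)" .
  qed
qed

section \<open>From compact to measurable subsets\<close>

text \<open>The conventions \<open>a / 0 = top\<close> for \<open>a \<noteq> 0\<close> and \<open>a / top = 0\<close> are the reason
  for requiring finite \<open>b\<close> and \<open>t\<close>.\<close>

lemma ennreal_le_mult_if_divide_le:
  fixes a b t :: ennreal
  assumes "a / t \<le> b" "b < top" "t < top"
  shows "a \<le> b * t"
proof (cases "t = 0")
  case True
  then have "a = 0"
    using assms by (cases "a = 0") (auto simp: ennreal_divide_zero top_unique)
  then show ?thesis by simp
next
  case False
  have "a = a / t * t"
    using False assms(3) by (simp add: ennreal_divide_times ennreal_mult_divide_eq)
  also have "\<dots> \<le> b * t" using assms(1) by (rule mult_right_mono) simp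
  finally show ?thesis .
qed

lemma ennreal_divide_le_if_le_mult:
  fixes a b t :: ennreal
  assumes "a \<le> b * t"
  shows "a / t \<le> b"
proof (cases "t = 0 \<or> t = top")
  case True
  then show ?thesis using assms by auto
next
  case False
  then show ?thesis
    using divide_right_mono_ennreal[OF assms, of t] by (simp add: ennreal_mult_divide_eq)
qed

theorem theorem2:
  fixes w :: "real ^ 'n \<Rightarrow> real" and p Cw :: real
  assumes "1 < p"
    and "weight w"
    and "Cp_condition p w"
    and "doubling_with Cw w"
    and "Cw < 3 powr (real CARD('n) * p)"
  shows "w \<in> A_infinity"
proof -
  \<comment> \<open>a negative constant acts as \<open>0\<close> in the doubling inequality, because \<open>ennreal\<close> truncates\<close>
  have D: "doubling_with (max Cw 0) w"
    using assms(4) by (auto simp: doubling_with_def max_def ennreal_neg)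
  have "0 < p" "max Cw 0 < 3 powr (real CARD('n) * p)"
    using assms(1,5) by auto
  then obtain K where K: "0 < K"
    "\<And>c l. 0 < l \<Longrightarrow> Cp_tail p w (cube c l) \<le> ennreal K * wmeas w (cube c l)"
    using Cp_tail_le_wmeas[OF _ assms(2) D] by auto
  obtain C \<epsilon> where C: "0 < C" "0 < \<epsilon>"
    and Cp_all: "\<forall>c l. 0 < l \<longrightarrow> Cp_tail p w (cube c l) < \<infinity> \<and>
      (\<forall>E. compact E \<and> E \<subseteq> cube c l \<longrightarrow> wmeas w E / Cp_tail p w (cube c l)
        \<le> ennreal (C * (measure lebesgue E / measure lebesgue (cube c l)) powr \<epsilon>))"
    using assms(3) unfolding Cp_condition_def by (elim exE conjE)
  have tail: "Cp_tail p w (cube c l) < \<infinity>" if "0 < l" for c l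
    using Cp_all that by blast
  have Cp: "wmeas w E / Cp_tail p w (cube c l)
      \<le> ennreal (C * (measure lebesgue E / measure lebesgue (cube c l)) powr \<epsilon>)"
    if "0 < l" "compact E" "E \<subseteq> cube c l" for c l E
    using Cp_all that by blast
  have "wmeas w E / wmeas w (cube c l)
      \<le> ennreal (C * K * (measure lebesgue E / measure lebesgue (cube c l)) powr \<epsilon>)"
    if l: "0 < l" and E: "E \<in> sets lebesgue" "E \<subseteq> cube c l" for c l E
  proof (rule ennreal_divide_le_if_le_mult[OF wmeas_le_if_compact_le[OF assms(2) E(1)]])
    fix F assume F: "compact F" "F \<subseteq> E"
    define \<rho> where "\<rho> = (\<lambda>A :: (real ^ 'n) set. (measure lebesgue A / measure lebesgue (cube c l)) powr \<epsilon>)"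
    have "E \<in> lmeasurable"
      by (rule fmeasurableI2[OF lmeasurable_compact[OF compact_cube] E(2,1)])
    then have "measure lebesgue F \<le> measure lebesgue E"
      using F lmeasurable_compact by (intro measure_mono_fmeasurable) auto
    then have \<rho>: "\<rho> F \<le> \<rho> E"
      unfolding \<rho>_def using C(2) by (intro powr_mono2 divide_right_mono) auto
    have "wmeas w F \<le> ennreal (C * \<rho> F) * Cp_tail p w (cube c l)"
      unfolding \<rho>_def using F E l tail[OF l]
      by (intro ennreal_le_mult_if_divide_le Cp) auto
    also have "\<dots> \<le> ennreal (C * \<rho> E) * (ennreal K * wmeas w (cube c l))"
      using \<rho> C(1) K(2)[OF l] by (intro mult_mono ennreal_leI mult_left_mono) auto
    also have "\<dots> = ennreal (C * K * \<rho> E) * wmeas w (cube c l)"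
    proof -
      have "ennreal (C * \<rho> E) * ennreal K = ennreal (C * K * \<rho> E)"
        using C(1) K(1) by (subst ennreal_mult[symmetric]) (simp_all add: \<rho>_def ac_simps)
      then show ?thesis by (simp only: mult.assoc[symmetric])
    qed
    finally show "wmeas w F
        \<le> ennreal (C * K * (measure lebesgue E / measure lebesgue (cube c l)) powr \<epsilon>)
          * wmeas w (cube c l)"
      by (simp add: \<rho>_def)
  qed
  moreover have "0 < C * K" using C(1) K(1) by simp
  ultimately show ?thesis
    using assms(2) C(2) unfolding A_infinity_def by blast
qed

end
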